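(* Let $G$ be an infinite countable ICC simple group belonging to one of the following two classes: (1) character rigid groups, i.e. groups $G$ whose set of indecomposable characters is exactly $\{\delta_e,\mathbf{1}_G\}$; (2) $L(Alt)$-groups, i.e. groups which can be expressed as $G=\bigcup_{i\in\mathbb{N}}G_i$, where $(G_i)_{i\in\mathbb{N}}$ is a strictly increasing chain of finite alternating groups. Then $G$ has non-factorizable regular character.
   Context: A group is ICC if every non-trivial element has an infinite conjugacy class. A character on a countable discrete group $G$ is a function $\phi: G\to\mathbb{C}$ that is positive definite, conjugation-invariant and normalized ($\phi(e)=1$). A character is indecomposable if it is an extreme point of the convex set of characters. $\delta_e$ is the Dirac function at the identity and $\mathbf{1}_G$ the constant function $1$. $G$ has non-factorizable regular character if for any characters $\phi,\psi$ on $G$ such that $\phi(s)\psi(s)=0$ for all $s\in G\setminus\{e\}$, one has $\phi\equiv\delta_e$ or $\psi\equiv\delta_e$. *)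

theory Defs
  imports
    "HOL-Algebra.Sym_Groups"
    "HOL-Library.Countable_Set"
    "HOL-Library.FuncSet"
    "HOL-Library.Nonpos_Ints"
begin

definition conjugacy_class :: "('a, 'b) monoid_scheme \<Rightarrow> 'a \<Rightarrow> 'a set" where
  "conjugacy_class G g =
     {x \<otimes>\<^bsub>G\<^esub> g \<otimes>\<^bsub>G\<^esub> inv\<^bsub>G\<^esub> x | x. x \<in> carrier G}"

definition icc :: "('a, 'b) monoid_scheme \<Rightarrow> bool" where
  "icc G \<longleftrightarrow> (\<forall>g \<in> carrier G - {\<one>\<^bsub>G\<^esub>}. infinite (conjugacy_class G g))"

text \<open>The locale \<open>simple_group\<close> of HOL-Algebra requires \<open>order G > 1\<close>, where
  \<open>order\<close> is the cardinality as a natural number and hence \<open>0\<close> for infinite groups.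
  Thus that locale only covers finite groups and cannot be used here.\<close>

definition is_simple :: "('a, 'b) monoid_scheme \<Rightarrow> bool" where
  "is_simple G \<longleftrightarrow> group G \<and> carrier G \<noteq> {\<one>\<^bsub>G\<^esub>} \<and>
     (\<forall>N. N \<lhd> G \<longrightarrow> N = carrier G \<or> N = {\<one>\<^bsub>G\<^esub>})"

text \<open>A complex number lies in \<open>\<real>\<^sub>\<ge>\<^sub>0\<close> iff it is real and nonnegative.
  The points \<open>g 0, \<dots>, g (n - 1)\<close> need not be distinct.\<close>

definition positive_definite_on_group ::
    "('a, 'b) monoid_scheme \<Rightarrow> ('a \<Rightarrow> complex) \<Rightarrow> bool" where
  "positive_definite_on_group G \<phi> \<longleftrightarrow>
     (\<forall>(n::nat) (g :: nat \<Rightarrow> 'a) (c :: nat \<Rightarrow> complex). (\<forall>i<n. g i \<in> carrier G) \<longrightarrow>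
        (\<Sum>i<n. \<Sum>j<n. cnj (c i) * c j * \<phi> (inv\<^bsub>G\<^esub> (g i) \<otimes>\<^bsub>G\<^esub> g j)) \<in> \<real>\<^sub>\<ge>\<^sub>0)"

text \<open>Functions on \<open>G\<close> are represented extensionally (\<open>undefined\<close> outside the carrier),
  so that HOL equality is equality of functions on \<open>G\<close>.\<close>

definition characters :: "('a, 'b) monoid_scheme \<Rightarrow> ('a \<Rightarrow> complex) set" where
  "characters G = {\<phi> \<in> extensional (carrier G).
     positive_definite_on_group G \<phi> \<and>
     (\<forall>g \<in> carrier G. \<forall>x \<in> carrier G.
        \<phi> (x \<otimes>\<^bsub>G\<^esub> g \<otimes>\<^bsub>G\<^esub> inv\<^bsub>G\<^esub> x) = \<phi> g) \<and>
     \<phi> \<one>\<^bsub>G\<^esub> = 1}"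

text \<open>The extreme points of the set of characters. The library's \<open>extreme_point_of\<close>
  is restricted to types of class \<open>real_vector\<close>, of which function types are not an
  instance.\<close>

definition indecomposable_characters ::
    "('a, 'b) monoid_scheme \<Rightarrow> ('a \<Rightarrow> complex) set" where
  "indecomposable_characters G = {\<phi> \<in> characters G.
     \<forall>\<psi> \<in> characters G. \<forall>\<chi> \<in> characters G. \<forall>t::real.
       0 < t \<and> t < 1 \<and>
       (\<forall>g \<in> carrier G.
          \<phi> g = complex_of_real t * \<psi> g + complex_of_real (1 - t) * \<chi> g)
       \<longrightarrow> \<psi> = \<phi> \<and> \<chi> = \<phi>}"

definition delta_e :: "('a, 'b) monoid_scheme \<Rightarrow> 'a \<Rightarrow> complex" where
  "delta_e G = (\<lambda>g \<in> carrier G. if g = \<one>\<^bsub>G\<^esub> then 1 else 0)"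

definition const_one :: "('a, 'b) monoid_scheme \<Rightarrow> 'a \<Rightarrow> complex" where
  "const_one G = (\<lambda>g \<in> carrier G. 1)"

definition character_rigid :: "('a, 'b) monoid_scheme \<Rightarrow> bool" where
  "character_rigid G \<longleftrightarrow> indecomposable_characters G = {delta_e G, const_one G}"

text \<open>The order on sets is inclusion, so \<open>strict_mono H\<close> says that the chain is strictly
  increasing. The degrees \<open>n\<close> may depend on \<open>i\<close>, and the inclusions
  \<open>H i \<subseteq> H (Suc i)\<close> need not come from inclusions of the permuted sets.\<close>

definition L_Alt_group :: "('a, 'b) monoid_scheme \<Rightarrow> bool" where
  "L_Alt_group G \<longleftrightarrow> (\<exists>H :: nat \<Rightarrow> 'a set.
     strict_mono H \<and>
     (\<forall>i. subgroup (H i) G \<and> (\<exists>n. G\<lparr>carrier := H i\<rparr> \<cong> alt_group n)) \<and>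
     carrier G = (\<Union>i. H i))"

definition non_factorizable_regular_character :: "('a, 'b) monoid_scheme \<Rightarrow> bool" where
  "non_factorizable_regular_character G \<longleftrightarrow>
     (\<forall>\<phi> \<in> characters G. \<forall>\<psi> \<in> characters G.
        (\<forall>s \<in> carrier G - {\<one>\<^bsub>G\<^esub>}. \<phi> s * \<psi> s = 0) \<longrightarrow>
        \<phi> = delta_e G \<or> \<psi> = delta_e G)"

end

theory Submission
  imports
    Defs
    "HOL-Analysis.Function_Topology"
    "HOL-Analysis.Uniform_Limit"
begin

text \<open>Character rigid groups: the characters form a compact set for pointwise convergence. If a
  character took different values at \<open>g, h \<noteq> e\<close>, the real part of a multiple of
  \<open>\<phi> g - \<phi> h\<close> would have a positive maximum, also attained at an indecomposable character;
  but it vanishes at \<open>\<delta>\<^sub>e\<close> and at \<open>1\<close>. So characters are constant off the identity.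

  \<open>L(Alt)\<close>-groups: positive definiteness bounds \<open>\<bar>\<phi> g\<bar>\<^sup>2\<close> by
  \<open>1/N\<close> plus the largest modulus of \<open>\<phi>\<close> at the quotients of \<open>N\<close> conjugates of
  \<open>g\<close>. Conjugating by suitable 3-cycles twice shows that a character of \<open>Alt(n)\<close> which
  vanishes at 3-cycles is uniformly small off the identity as \<open>n\<close> grows. Hence any two
  characters other than \<open>\<delta>\<^sub>e\<close> are both nonzero at the 3-cycles of all large
  \<open>Alt(n)\<close> in the chain.\<close>

section \<open>Estimates from positive definiteness\<close>

text \<open>Cauchy-Schwarz in the form of one positive definite sum over the points
  \<open>\<one>\<close> and \<open>x k\<close>. With \<open>S\<close> the sum of
  \<open>\<phi>\<close> over all quotients, that sum equals \<open>S\<close> minus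
  \<open>N ^ 2 * cmod z ^ 2\<close>. The diagonal of \<open>S\<close> contributes \<open>N\<close>,
  and every other term is at most \<open>d\<close> in modulus.\<close>

lemma gram_sum_bound:
  fixes G :: "('a, 'b) monoid_scheme"
  assumes "group G" and "0 \<le> d" and pd: "positive_definite_on_group G \<phi>" and one: "\<phi> \<one>\<^bsub>G\<^esub> = 1"
    and x: "\<And>k. k < N \<Longrightarrow> x k \<in> carrier G"
    and sym: "\<And>k. k < N \<Longrightarrow> \<phi> (inv\<^bsub>G\<^esub> (x k)) = cnj (\<phi> (x k))"
    and z: "\<And>k. k < N \<Longrightarrow> \<phi> (x k) = z"
    and d: "\<And>j k. j < N \<Longrightarrow> k < N \<Longrightarrow> j \<noteq> k \<Longrightarrow> cmod (\<phi> (inv\<^bsub>G\<^esub> (x j) \<otimes>\<^bsub>G\<^esub> x k)) \<le> d"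
  shows "real N ^ 2 * cmod z ^ 2 \<le> real N + real N ^ 2 * d"
proof (cases "N = 0")
  case False
  interpret group G by fact
  define g where "g = (\<lambda>i. case i of 0 \<Rightarrow> \<one>\<^bsub>G\<^esub> | Suc k \<Rightarrow> x k)"
  \<comment> \<open>The weight at the identity minimises the quadratic form once the other weights
    are 1.\<close>
  define c where "c = (\<lambda>i::nat. case i of 0 \<Rightarrow> - (of_nat N * z) | Suc k \<Rightarrow> 1)"
  define S where "S = (\<Sum>j<N. \<Sum>k<N. \<phi> (inv\<^bsub>G\<^esub> (x j) \<otimes>\<^bsub>G\<^esub> x k))"
  have gin: "\<forall>i<Suc N. g i \<in> carrier G"
    using x by (auto simp: g_def split: nat.splits)
  have "(\<Sum>i<Suc N. \<Sum>j<Suc N. cnj (c i) * c j * \<phi> (inv\<^bsub>G\<^esub> (g i) \<otimes>\<^bsub>G\<^esub> g j))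
      = cnj (c 0) * c 0 * \<phi> (inv\<^bsub>G\<^esub> (g 0) \<otimes>\<^bsub>G\<^esub> g 0)
        + (\<Sum>k<N. cnj (c 0) * c (Suc k) * \<phi> (inv\<^bsub>G\<^esub> (g 0) \<otimes>\<^bsub>G\<^esub> g (Suc k)))
        + (\<Sum>k<N. cnj (c (Suc k)) * c 0 * \<phi> (inv\<^bsub>G\<^esub> (g (Suc k)) \<otimes>\<^bsub>G\<^esub> g 0))
        + (\<Sum>j<N. \<Sum>k<N. cnj (c (Suc j)) * c (Suc k) * \<phi> (inv\<^bsub>G\<^esub> (g (Suc j)) \<otimes>\<^bsub>G\<^esub> g (Suc k)))"
    by (simp only: sum.lessThan_Suc_shift sum.distrib ac_simps)
  also have "\<dots> = (of_nat N * cnj z) * (of_nat N * z) + (\<Sum>k<N. - (of_nat N * cnj z * z))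
        + (\<Sum>k<N. - (of_nat N * z * cnj z)) + S"
    unfolding S_def using x sym z one
    by (intro arg_cong2[where f="(+)"] sum.cong refl) (auto simp: g_def c_def)
  also have "\<dots> = S - of_real (real N ^ 2 * cmod z ^ 2)"
    by (simp add: power2_eq_square algebra_simps flip: complex_norm_square)
  finally have "S - of_real (real N ^ 2 * cmod z ^ 2) \<in> \<real>\<^sub>\<ge>\<^sub>0"
    using pd[unfolded positive_definite_on_group_def, rule_format, of "Suc N" g c] gin by simp
  then have "real N ^ 2 * cmod z ^ 2 \<le> Re S"
    by (simp add: complex_nonneg_Reals_iff)
  also have "Re S \<le> cmod S" by (rule complex_Re_le_cmod)
  also have "\<dots> \<le> (\<Sum>j<N. \<Sum>k<N. (if j = k then 1 else 0) + d)"
    unfolding S_def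
  proof (intro sum_norm_le)
    fix j k assume "j \<in> {..<N}" "k \<in> {..<N}"
    then show "cmod (\<phi> (inv\<^bsub>G\<^esub> (x j) \<otimes>\<^bsub>G\<^esub> x k)) \<le> (if j = k then 1 else 0) + d"
      using d[of j k] x[of j] one \<open>0 \<le> d\<close> by (cases "j = k") auto
  qed
  also have "\<dots> = real N + real N ^ 2 * d"
    by (simp add: sum.distrib power2_eq_square algebra_simps)
  finally show ?thesis .
qed simp

text \<open>The form on the two points \<open>\<one>\<close> and \<open>x\<close> with weights 1 and
  \<open>a\<close> has imaginary part zero. Taking \<open>a = 1\<close> compares the imaginary parts
  of the two values, and \<open>a = \<i>\<close> the real parts.\<close>

lemma positive_definite_hermitian:
  fixes G :: "('a, 'b) monoid_scheme"
  assumes "group G" and pd: "positive_definite_on_group G \<phi>" and one: "\<phi> \<one>\<^bsub>G\<^esub> = 1"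
    and x: "x \<in> carrier G"
  shows "\<phi> (inv\<^bsub>G\<^esub> x) = cnj (\<phi> x)"
proof -
  interpret group G by fact
  have two: "1 + cnj a * a + cnj a * \<phi> (inv\<^bsub>G\<^esub> x) + a * \<phi> x \<in> \<real>\<^sub>\<ge>\<^sub>0" for a
  proof -
    define g where "g = (\<lambda>i::nat. if i = 0 then \<one>\<^bsub>G\<^esub> else x)"
    define c where "c = (\<lambda>i::nat. if i = 0 then 1 else a)"
    have "\<forall>i<2. g i \<in> carrier G" using x by (simp add: g_def)
    then have "(\<Sum>i<2. \<Sum>j<2. cnj (c i) * c j * \<phi> (inv\<^bsub>G\<^esub> (g i) \<otimes>\<^bsub>G\<^esub> g j)) \<in> \<real>\<^sub>\<ge>\<^sub>0"
      using pd[unfolded positive_definite_on_group_def, rule_format, of 2 g c] by simp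
    then show ?thesis
      using x one by (simp add: g_def c_def numeral_2_eq_2 algebra_simps)
  qed
  from two[of 1] two[of \<i>] show ?thesis
    by (auto simp: complex_nonneg_Reals_iff complex_eq_iff)
qed

text \<open>The previous estimate divided by the square of the number of points. In the application
  the points are conjugates of one element, so the character is constant on them.\<close>

lemma character_gram_bound:
  fixes G :: "('a, 'b) monoid_scheme"
  assumes "group G" and \<phi>: "\<phi> \<in> characters G" and d: "0 \<le> d"
    and A: "finite A" "A \<noteq> {}" "x ` A \<subseteq> carrier G"
    and z: "\<And>k. k \<in> A \<Longrightarrow> \<phi> (x k) = z"
    and le: "\<And>j k. j \<in> A \<Longrightarrow> k \<in> A \<Longrightarrow> j \<noteq> k \<Longrightarrow> cmod (\<phi> (inv\<^bsub>G\<^esub> (x j) \<otimes>\<^bsub>G\<^esub> x k)) \<le> d"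
  shows "cmod z ^ 2 \<le> 1 / real (card A) + d"
proof -
  obtain h where h: "bij_betw h {0..<card A} A"
    using A(1) ex_bij_betw_nat_finite by blast
  have hA: "h k \<in> A" if "k < card A" for k
    using h that by (auto simp: bij_betw_def)
  have hinj: "h j \<noteq> h k" if "j < card A" "k < card A" "j \<noteq> k" for j k
    using h that by (auto simp: bij_betw_def inj_on_def)
  have pd: "positive_definite_on_group G \<phi>" and one: "\<phi> \<one>\<^bsub>G\<^esub> = 1"
    using \<phi> by (auto simp: characters_def)
  have "real (card A) ^ 2 * cmod z ^ 2 \<le> real (card A) + real (card A) ^ 2 * d"
    using A hA hinj z le
    by (intro gram_sum_bound[OF assms(1) d pd one, where x = "\<lambda>k. x (h k)"]
        positive_definite_hermitian[OF assms(1) pd one]) (auto simp: image_subset_iff)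
  moreover have pos: "real (card A) > 0"
    using A by (simp add: card_gt_0_iff)
  ultimately have "cmod z ^ 2 \<le> (real (card A) + real (card A) ^ 2 * d) / real (card A) ^ 2"
    by (subst pos_le_divide_eq) (simp_all add: mult.commute)
  also have "\<dots> = 1 / real (card A) + d"
    using pos by (simp add: add_divide_distrib power2_eq_square)
  finally show ?thesis .
qed

lemma character_norm_le_one:
  fixes G :: "('a, 'b) monoid_scheme"
  assumes "group G" and \<phi>: "\<phi> \<in> characters G" and g: "g \<in> carrier G"
  shows "cmod (\<phi> g) \<le> 1"
proof -
  \<comment> \<open>A single point leaves no pair of distinct indices, so \<open>d = 0\<close> is
    allowed.\<close>
  have "cmod (\<phi> g) ^ 2 \<le> 1 / real (card {()}) + 0"
    by (rule character_gram_bound[OF assms(1) \<phi>, where x = "\<lambda>_. g"]) (use g in auto)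
  then show ?thesis
    by (simp add: abs_square_le_1)
qed

section \<open>Compactness, extreme points and character rigid groups\<close>

text \<open>By Tychonoff: the characters are cut out by closed pointwise conditions inside a product
  of unit discs.\<close>

lemma compact_characters:
  fixes G :: "('a, 'b) monoid_scheme"
  assumes "group G"
  shows "compact (characters G)"
proof -
  \<comment> \<open>The one-point factors encode extensionality outside the carrier.\<close>
  define S where "S = (\<lambda>i. if i \<in> carrier G then cball (0::complex) 1 else {undefined})"
  have "compactin (product_topology (\<lambda>_. euclidean) UNIV) (PiE UNIV S)"
    by (subst compactin_PiE) (auto simp: S_def)
  then have comp: "compact (PiE UNIV S)"
    by (simp add: euclidean_product_topology)
  have [continuous_intros]: "continuous_on UNIV (\<lambda>\<phi>. \<phi> i)" for i :: 'a
    by (rule continuous_on_product_coordinates)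
  have "closed {\<phi> :: 'a \<Rightarrow> complex. positive_definite_on_group G \<phi> \<and>
     (\<forall>g \<in> carrier G. \<forall>x \<in> carrier G.
        \<phi> (x \<otimes>\<^bsub>G\<^esub> g \<otimes>\<^bsub>G\<^esub> inv\<^bsub>G\<^esub> x) = \<phi> g) \<and> \<phi> \<one>\<^bsub>G\<^esub> = 1}"
    unfolding positive_definite_on_group_def Ball_def complex_nonneg_Reals_iff
    by (intro closed_Collect_conj closed_Collect_all closed_Collect_imp open_Collect_const
        closed_Collect_eq closed_Collect_le continuous_intros)
  moreover have "characters G = {\<phi> :: 'a \<Rightarrow> complex. positive_definite_on_group G \<phi> \<and>
     (\<forall>g \<in> carrier G. \<forall>x \<in> carrier G.
        \<phi> (x \<otimes>\<^bsub>G\<^esub> g \<otimes>\<^bsub>G\<^esub> inv\<^bsub>G\<^esub> x) = \<phi> g) \<and> \<phi> \<one>\<^bsub>G\<^esub> = 1} \<inter> PiE UNIV S"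
    using character_norm_le_one[OF assms]
    by (auto simp: characters_def S_def PiE_def Pi_def extensional_def split: if_splits)
  ultimately show ?thesis
    using comp by (simp add: closed_Int_compact)
qed

text \<open>An extreme point is produced by maximising twice: first the affine functional
  \<open>f\<close> over all characters, then a strictly convex \<open>q\<close> over the face
  \<open>F\<close> of maximisers of \<open>f\<close>.\<close>

lemma character_rigid_constant_off_one:
  fixes G :: "('a, 'b) monoid_scheme"
  assumes "group G" and count: "countable (carrier G)" and rigid: "character_rigid G"
    and \<phi>: "\<phi> \<in> characters G"
    and g: "g \<in> carrier G - {\<one>\<^bsub>G\<^esub>}" and h: "h \<in> carrier G - {\<one>\<^bsub>G\<^esub>}"
  shows "\<phi> g = \<phi> h"
proof (rule ccontr)
  assume neq: "\<phi> g \<noteq> \<phi> h"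
  let ?K = "characters G"
  \<comment> \<open>This factor turns the difference of the two values of \<open>\<phi>\<close> into
    its squared modulus, which is positive.\<close>
  define a where "a = cnj (\<phi> g - \<phi> h)"
  define f where "f = (\<lambda>\<xi> :: 'a \<Rightarrow> complex. Re (a * (\<xi> g - \<xi> h)))"
  have coord[continuous_intros]: "continuous_on A (\<lambda>\<phi>. \<phi> i)" for i :: 'a and A :: "('a \<Rightarrow> complex) set"
    by (rule continuous_on_subset[OF continuous_on_product_coordinates]) simp
  have "f \<phi> = cmod (\<phi> g - \<phi> h)^2"
    unfolding f_def a_def cmod_power2 by (simp add: power2_eq_square algebra_simps)
  with neq have "f \<phi> > 0" by simp
  have contf: "continuous_on A f" for A
    unfolding f_def by (intro continuous_intros)
  have neK: "?K \<noteq> {}" using \<phi> by auto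
  obtain \<mu> where \<mu>: "\<mu> \<in> ?K" "\<And>\<xi>. \<xi> \<in> ?K \<Longrightarrow> f \<xi> \<le> f \<mu>"
    using continuous_attains_sup[OF compact_characters[OF assms(1)] neK contf] by auto
  define F where "F = ?K \<inter> {\<xi>. f \<mu> \<le> f \<xi>}"
  have "compact F"
    unfolding F_def using compact_characters[OF assms(1)]
    by (intro compact_Int_closed closed_Collect_le contf continuous_on_const)
  have ne: "carrier G \<noteq> {}" using g by auto
  define w where "w = from_nat_into (carrier G)"
  have w: "w n \<in> carrier G" for n
    using ne by (simp add: w_def from_nat_into)
  have wsurj: "\<exists>n. w n = s" if "s \<in> carrier G" for s
    using that count from_nat_into_surj unfolding w_def by metis
  \<comment> \<open>A strictly convex functional, so that its maximiser on the face \<open>F\<close> is an extreme point.\<close>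
  define q where "q = (\<lambda>\<xi> :: 'a \<Rightarrow> complex. \<Sum>n. (1/2)^n * cmod (\<xi> (w n))^2)"
  have geom: "summable (\<lambda>n. (1/2::real)^n)" by (rule summable_geometric) simp
  have term_le: "norm ((1/2)^n * cmod (\<xi> (w n))^2) \<le> (1/2)^n" if "\<xi> \<in> ?K" for n \<xi>
  proof -
    have "cmod (\<xi> (w n))^2 \<le> 1"
      using character_norm_le_one[OF assms(1) that w] by (simp add: power_le_one)
    then show ?thesis by (simp add: field_simps)
  qed
  have contq: "continuous_on F q"
  proof (rule uniform_limit_theorem)
    show "uniform_limit F (\<lambda>m \<xi>. \<Sum>n<m. (1/2)^n * cmod (\<xi> (w n))^2) q sequentially"
      unfolding q_def by (rule Weierstrass_m_test[OF _ geom], rule term_le) (simp add: F_def)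
    show "\<forall>\<^sub>F m in sequentially. continuous_on F (\<lambda>\<xi>. \<Sum>n<m. (1/2)^n * cmod (\<xi> (w n))^2)"
      by (intro always_eventually allI continuous_intros)
  qed simp
  have "\<mu> \<in> F" using \<mu> by (simp add: F_def)
  then have neF: "F \<noteq> {}" by auto
  obtain \<nu> where \<nu>: "\<nu> \<in> F" "\<And>\<xi>. \<xi> \<in> F \<Longrightarrow> q \<xi> \<le> q \<nu>"
    using continuous_attains_sup[OF \<open>compact F\<close> neF contq] by auto
  have "\<nu> \<in> indecomposable_characters G"
    unfolding indecomposable_characters_def
  proof (intro CollectI conjI[of "\<nu> \<in> ?K"] ballI allI impI)
    show "\<nu> \<in> ?K" using \<nu> by (simp add: F_def)
    fix \<psi> \<xi> and t :: real
    assume \<psi>: "\<psi> \<in> ?K" and \<xi>: "\<xi> \<in> ?K" and t: "0 < t \<and> t < 1 \<and> (\<forall>g\<in>carrier G. \<nu> g =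
          complex_of_real t * \<psi> g + complex_of_real (1 - t) * \<xi> g)"
    have eq: "\<nu> s = complex_of_real t * \<psi> s + complex_of_real (1 - t) * \<xi> s" if "s \<in> carrier G" for s
      using t that by blast
    have fcomb: "f \<nu> = t * f \<psi> + (1 - t) * f \<xi>"
    proof -
      have gh: "g \<in> carrier G" "h \<in> carrier G" using g h by auto
      show ?thesis
        unfolding f_def eq[OF gh(1)] eq[OF gh(2)] by (simp add: algebra_simps)
    qed
    have f\<nu>: "f \<nu> = f \<mu>" using \<nu> \<mu> by (force simp: F_def intro: antisym)
    \<comment> \<open>\<open>F\<close> is a face: a proper average of two values can equal the
      maximum only if both values do.\<close>
    have "t * f \<psi> \<le> t * f \<mu>" "(1 - t) * f \<xi> \<le> (1 - t) * f \<mu>"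
      using t \<mu> \<psi> \<xi> by auto
    with fcomb f\<nu> have "t * f \<psi> = t * f \<mu>" "(1 - t) * f \<xi> = (1 - t) * f \<mu>"
      by (auto simp: algebra_simps)
    then have FF: "\<psi> \<in> F" "\<xi> \<in> F"
      using t \<psi> \<xi> by (auto simp: F_def)
    \<comment> \<open>The defect of convexity of the squared modulus. Summed with the weights of
      \<open>q\<close>, it is the series \<open>D\<close>, which the maximality of
      \<open>\<nu>\<close> forces to vanish.\<close>
    have norm_comb: "cmod (of_real t * u + of_real (1 - t) * v)^2
        = t * cmod u ^ 2 + (1 - t) * cmod v ^ 2 - t * (1 - t) * cmod (u - v)^2" for u v
      by (simp add: cmod_power2) (simp add: power2_eq_square algebra_simps)
    define D where "D = (\<lambda>n. (1/2)^n * cmod (\<psi> (w n) - \<xi> (w n))^2)"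
    have sums: "summable (\<lambda>n. (1/2)^n * cmod (\<xi> (w n))^2)" if "\<xi> \<in> ?K" for \<xi>
      using summable_comparison_test'[OF geom term_le[OF that]] by blast
    have term_eq: "(1/2)^n * cmod (\<nu> (w n))^2 = t * ((1/2)^n * cmod (\<psi> (w n))^2)
       + (1 - t) * ((1/2)^n * cmod (\<xi> (w n))^2) - t * (1 - t) * D n" for n
      unfolding eq[OF w] norm_comb D_def by (simp add: algebra_simps)
    have D_le: "norm (D n) \<le> 4 * (1/2)^n" for n
    proof -
      have "cmod (\<psi> (w n) - \<xi> (w n)) \<le> 2"
        using character_norm_le_one[OF assms(1) \<psi> w, of n] character_norm_le_one[OF assms(1) \<xi> w, of n]
          norm_triangle_ineq4[of "\<psi> (w n)" "\<xi> (w n)"] by linarith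
      then have "cmod (\<psi> (w n) - \<xi> (w n))^2 \<le> 2^2"
        by (intro power_mono) auto
      then show ?thesis by (simp add: D_def)
    qed
    have sD: "summable D"
      by (rule summable_comparison_test'[OF summable_mult[OF geom] D_le])
    have "(\<lambda>n. t * ((1/2)^n * cmod (\<psi> (w n))^2) + (1 - t) * ((1/2)^n * cmod (\<xi> (w n))^2) - t * (1 - t) * D n)
        sums (t * q \<psi> + (1 - t) * q \<xi> - t * (1 - t) * suminf D)"
      unfolding q_def by (intro sums_diff sums_add sums_mult summable_sums sD sums \<psi> \<xi>)
    then have "q \<nu> = t * q \<psi> + (1 - t) * q \<xi> - t * (1 - t) * suminf D"
      unfolding q_def term_eq[symmetric] by (simp add: sums_iff)
    moreover have "t * q \<psi> \<le> t * q \<nu>" "(1 - t) * q \<xi> \<le> (1 - t) * q \<nu>"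
      using t \<nu>(2)[OF FF(1)] \<nu>(2)[OF FF(2)] by auto
    ultimately have "t * (1 - t) * suminf D \<le> 0"
      by (simp add: algebra_simps)
    then have "suminf D \<le> 0"
      using t by (simp add: mult_le_0_iff)
    moreover have D0: "D n \<ge> 0" for n by (simp add: D_def)
    ultimately have "D n = 0" for n
      using suminf_eq_zero_iff[OF sD D0] suminf_nonneg[OF sD D0] by simp
    then have same: "\<psi> (w n) = \<xi> (w n)" for n
      by (simp add: D_def)
    have "\<psi> s = \<nu> s \<and> \<xi> s = \<nu> s" for s
    proof (cases "s \<in> carrier G")
      case True
      then have "\<psi> s = \<xi> s" using same wsurj by metis
      then show ?thesis using eq[OF True] by (simp add: algebra_simps)
    next
      case False
      then show ?thesis
        using \<psi> \<xi> \<nu> by (auto simp: F_def characters_def extensional_def)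
    qed
    then show "\<psi> = \<nu> \<and> \<xi> = \<nu>" by auto
  qed
  then have "\<nu> = delta_e G \<or> \<nu> = const_one G"
    using rigid by (auto simp: character_rigid_def)
  \<comment> \<open>Both candidates for \<open>\<nu>\<close> take equal values at \<open>g\<close>
    and \<open>h\<close>, as neither point is the identity.\<close>
  then have "f \<nu> = 0"
    using g h by (auto simp: f_def delta_e_def const_one_def)
  moreover have "f \<nu> \<ge> f \<phi>" using \<nu> \<mu>(2)[OF \<phi>] by (auto simp: F_def)
  ultimately show False using \<open>f \<phi> > 0\<close> by simp
qed

section \<open>Three-cycles in alternating groups\<close>

text \<open>For distinct points this is the cycle from \<open>a\<close> to \<open>b\<close> to
  \<open>c\<close> and back to \<open>a\<close>. Two transpositions make evenness, bijectivity and
  the inverse immediate.\<close>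

definition three_cyc :: "'a \<Rightarrow> 'a \<Rightarrow> 'a \<Rightarrow> 'a \<Rightarrow> 'a" where
  "three_cyc a b c = Transposition.transpose a b \<circ> Transposition.transpose b c"

lemma three_cyc_apply:
  assumes "a \<noteq> b" "b \<noteq> c" "a \<noteq> c"
  shows "three_cyc a b c x = (if x = a then b else if x = b then c else if x = c then a else x)"
  using assms by (auto simp: three_cyc_def Transposition.transpose_def)

lemma bij_three_cyc: "bij (three_cyc a b c)"
  unfolding three_cyc_def by (intro bij_comp bij_transpose)

lemma inv_three_cyc: "inv' (three_cyc a b c) = three_cyc c b a"
  unfolding three_cyc_def by (simp add: o_inv_distrib transpose_commute)

lemma three_cyc_conj:
  assumes "bij p"
  shows "p \<circ> three_cyc a b c \<circ> inv' p = three_cyc (p a) (p b) (p c)"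
proof
  fix x
  obtain y where "x = p y" using assms bij_pointE by metis
  then show "(p \<circ> three_cyc a b c \<circ> inv' p) x = three_cyc (p a) (p b) (p c) x"
    using assms by (auto simp: three_cyc_def Transposition.transpose_def bij_is_inj inj_eq)
qed

lemma three_cyc_in_alt_group:
  assumes "a \<noteq> b" "b \<noteq> c" "{a, b, c} \<subseteq> {1..n}"
  shows "three_cyc a b c \<in> carrier (alt_group n)"
  using assms unfolding alt_group_carrier three_cyc_def
  by (auto intro!: permutes_compose permutes_swap_id simp: evenperm_comp permutation_swap_id evenperm_swap)

text \<open>Three transpositions put \<open>a\<close>, \<open>b\<close>, \<open>c\<close> in place
  one after another. An odd result is corrected by swapping two points outside the target triple,
  which exist because \<open>n\<close> is at least 5.\<close>

lemma alt_group_transitive_on_triples: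
  assumes n: "5 \<le> n"
    and abc: "a \<noteq> b" "b \<noteq> c" "a \<noteq> c" "{a, b, c} \<subseteq> {1..n}"
    and abc': "a' \<noteq> b'" "b' \<noteq> c'" "a' \<noteq> c'" "{a', b', c'} \<subseteq> {1..n}"
  obtains p where "p \<in> carrier (alt_group n)" "p a = a'" "p b = b'" "p c = c'"
proof -
  define p1 where "p1 = Transposition.transpose a a'"
  define p2 where "p2 = Transposition.transpose (p1 b) b' \<circ> p1"
  define p3 where "p3 = Transposition.transpose (p2 c) c' \<circ> p2"
  have p1: "p1 permutes {1..n}" "p1 a = a'"
    using abc abc' by (auto simp: p1_def intro: permutes_swap_id)
  have ne1: "p1 b \<noteq> a'" "p1 c \<noteq> a'" "p1 b \<noteq> p1 c" "p1 b \<in> {1..n}" "p1 c \<in> {1..n}"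
    using p1 abc permutes_inj[OF p1(1)] permutes_in_image[OF p1(1)] by (metis injD insert_subset)+
  have p2: "p2 permutes {1..n}" "p2 a = a'" "p2 b = b'"
    using p1 ne1 abc' by (auto simp: p2_def Transposition.transpose_def intro!: permutes_compose permutes_swap_id)
  have ne2: "p2 c \<noteq> a'" "p2 c \<noteq> b'" "p2 c \<in> {1..n}"
    using p2 abc permutes_inj[OF p2(1)] permutes_in_image[OF p2(1)] by (metis injD insert_subset)+
  have p3: "p3 permutes {1..n}" "p3 a = a'" "p3 b = b'" "p3 c = c'"
    using p2 ne2 abc' by (auto simp: p3_def Transposition.transpose_def intro!: permutes_compose permutes_swap_id)
  show thesis
  proof (cases "evenperm p3")
    case True
    then show thesis using that p3 by (simp add: alt_group_carrier)
  next
    case False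
    have "card ({1..n} - {a', b', c'}) \<ge> 2"
      using abc' n by (subst card_Diff_subset) auto
    then obtain d e where de: "d \<in> {1..n} - {a', b', c'}" "e \<in> {1..n} - {a', b', c'}" "d \<noteq> e"
      by (metis card_le_Suc0_iff_eq finite_Diff finite_atLeastAtMost not_less_eq_eq numeral_2_eq_2)
    have "evenperm (Transposition.transpose d e \<circ> p3)"
      using False de p3(1) permutation_permutes
      by (subst evenperm_comp) (auto simp: permutation_swap_id evenperm_swap)
    then show thesis
      using p3 de permutes_compose[OF p3(1) permutes_swap_id[of d "{1..n}" e]]
      by (intro that[of "Transposition.transpose d e \<circ> p3"])
        (auto simp: alt_group_carrier Transposition.transpose_def)
  qed
qed

section \<open>Characters of alternating groups that vanish at 3-cycles\<close>

lemma character_alt_group_conj: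
  assumes "\<phi> \<in> characters (alt_group n)" "g \<in> carrier (alt_group n)" "x \<in> carrier (alt_group n)"
  shows "\<phi> (x \<circ> g \<circ> inv' x) = \<phi> g"
  using assms by (auto simp: characters_def alt_group_mult alt_group_inv_equality)

text \<open>Any two 3-cycles are conjugate by an even permutation, by transitivity on
  triples.\<close>

lemma character_three_cyc_eq:
  assumes n: "5 \<le> n" and \<phi>: "\<phi> \<in> characters (alt_group n)"
    and abc: "a \<noteq> b" "b \<noteq> c" "a \<noteq> c" "{a, b, c} \<subseteq> {1..n}"
    and abc': "a' \<noteq> b'" "b' \<noteq> c'" "a' \<noteq> c'" "{a', b', c'} \<subseteq> {1..n}"
  shows "\<phi> (three_cyc a b c) = \<phi> (three_cyc a' b' c')"
proof -
  obtain p where p: "p \<in> carrier (alt_group n)" "p a = a'" "p b = b'" "p c = c'"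
    using alt_group_transitive_on_triples[OF n abc abc'] .
  then have "bij p" using permutes_bij by (auto simp: alt_group_carrier)
  then show ?thesis
    using character_alt_group_conj[OF \<phi> three_cyc_in_alt_group p(1), of a b c]
      three_cyc_conj[of p a b c] p abc by simp
qed

text \<open>Conjugates of \<open>w\<close> by 3-cycles \<open>(a b x)\<close> with \<open>a = w\<^sup>-\<^sup>1 b\<close>: the quotient
  of two of them is conjugate to the product of the 3-cycles
  \<open>w\<^sup>-\<^sup>1 (b y x) w = (a, w\<^sup>-\<^sup>1 y, w\<^sup>-\<^sup>1 x)\<close> and \<open>(x y b)\<close>, so it moves at most
  six points, and if \<open>x, y\<close> are fixed by \<open>w\<close> it is conjugate to the 3-cycle \<open>(b a y)\<close>.\<close>

lemma conj_quotient:
  assumes w: "bij w" and a: "w a = b" and d: "a \<noteq> b" "x \<noteq> a" "x \<noteq> b" "y \<noteq> a" "y \<noteq> b" "x \<noteq> y"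
  defines "s \<equiv> three_cyc a b"
  shows "inv' (s x \<circ> w \<circ> inv' (s x)) \<circ> (s y \<circ> w \<circ> inv' (s y))
    = s x \<circ> (three_cyc a (inv' w y) (inv' w x) \<circ> three_cyc x y b) \<circ> inv' (s x)"
proof -
  have bs: "bij (s z)" for z unfolding s_def by (rule bij_three_cyc)
  have t: "inv' (s x) \<circ> s y = three_cyc b y x"
    using d by (auto simp: s_def inv_three_cyc three_cyc_apply)
  \<comment> \<open>Read from right to left, this replaces the trailing \<open>inv' (s y)\<close> by
    a product ending in \<open>inv' (s x)\<close>, so that the quotient becomes a conjugate by
    \<open>s x\<close>.\<close>
  have t': "three_cyc x y b \<circ> inv' (s x) = inv' (s y)"
    using d by (auto simp: s_def inv_three_cyc three_cyc_apply)
  have wb: "inv' w b = a" using w a by (metis bij_is_inj inv_f_f)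
  have c: "inv' w \<circ> three_cyc b y x \<circ> w = three_cyc a (inv' w y) (inv' w x)"
    using three_cyc_conj[OF bij_imp_bij_inv[OF w], of b y x] w wb by (simp add: inv_inv_eq)
  have "inv' (s x \<circ> w \<circ> inv' (s x)) = s x \<circ> inv' w \<circ> inv' (s x)"
    using bs w by (simp add: o_inv_distrib bij_comp bij_imp_bij_inv inv_inv_eq comp_assoc)
  then have "inv' (s x \<circ> w \<circ> inv' (s x)) \<circ> (s y \<circ> w \<circ> inv' (s y))
      = s x \<circ> (inv' w \<circ> (inv' (s x) \<circ> s y) \<circ> w) \<circ> inv' (s y)"
    by (simp add: comp_assoc)
  then show ?thesis unfolding t c by (simp add: comp_assoc t')
qed

text \<open>\<open>character_gram_bound\<close> for the conjugates of \<open>w\<close> by the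
  3-cycles \<open>three_cyc a b x\<close> with \<open>x\<close> in \<open>X\<close>. By
  \<open>conj_quotient\<close> their quotients are conjugate to the products in the last hypothesis,
  so \<open>\<phi>\<close> agrees there.\<close>

lemma character_alt_group_conj_bound:
  assumes \<phi>: "\<phi> \<in> characters (alt_group n)" and w: "w \<in> carrier (alt_group n)" "w a = b" "a \<noteq> b"
    and X: "X \<subseteq> {1..n} - {a, b}" "X \<noteq> {}" and d: "0 \<le> d"
    and le: "\<And>x y. x \<in> X \<Longrightarrow> y \<in> X \<Longrightarrow> x \<noteq> y \<Longrightarrow>
      cmod (\<phi> (three_cyc a (inv' w y) (inv' w x) \<circ> three_cyc x y b)) \<le> d"
  shows "cmod (\<phi> w)^2 \<le> 1 / real (card X) + d"
proof -
  interpret alt: group "alt_group n" by (rule alt_group_is_group)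
  let ?s = "three_cyc a b"
  have wp: "w permutes {1..n}" using w by (simp add: alt_group_carrier)
  then have bw: "bij w" by (rule permutes_bij)
  have ab: "a \<in> {1..n}" "b \<in> {1..n}"
    using wp w permutes_not_in permutes_in_image by metis+
  have s: "?s x \<in> carrier (alt_group n)" if "x \<in> X" for x
    using X that ab w by (intro three_cyc_in_alt_group) auto
  have sw: "?s x \<circ> w \<circ> inv' (?s x) \<in> carrier (alt_group n)" if "x \<in> X" for x
    using alt.m_closed[OF alt.m_closed[OF s[OF that] w(1)] alt_group_inv_closed[OF s[OF that]]]
    by (simp add: alt_group_mult)
  show ?thesis
  proof (rule character_gram_bound[OF alt_group_is_group \<phi> d])
    show "finite X" using X finite_subset by blast
    show "X \<noteq> {}" by fact
    show "(\<lambda>x. ?s x \<circ> w \<circ> inv' (?s x)) ` X \<subseteq> carrier (alt_group n)" using sw by blast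
    show "\<phi> (?s k \<circ> w \<circ> inv' (?s k)) = \<phi> w" if "k \<in> X" for k
      by (rule character_alt_group_conj[OF \<phi> w(1) s[OF that]])
    fix x y assume xy: "x \<in> X" "y \<in> X" "x \<noteq> y"
    have xX: "x \<in> {1..n}" "y \<in> {1..n}" "x \<noteq> a" "y \<noteq> a" "x \<noteq> b" "y \<noteq> b"
      using xy X by auto
    have i: "inv' w y \<in> {1..n}" "inv' w x \<in> {1..n}" "inv' w y \<noteq> inv' w x" "a \<noteq> inv' w y"
      using xy X wp w permutes_inv[OF wp] permutes_in_image[OF permutes_inv[OF wp]]
        permutes_inverses[OF wp] by (blast, blast, metis, metis DiffD2 insertI1 insertI2 subsetD)
    have "three_cyc a (inv' w y) (inv' w x) \<circ> three_cyc x y b \<in> carrier (alt_group n)"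
      using alt.m_closed[OF three_cyc_in_alt_group three_cyc_in_alt_group, of a "inv' w y" "inv' w x" x y b]
        xy(3) xX i ab by (simp add: alt_group_mult)
    moreover have "inv' (?s x \<circ> w \<circ> inv' (?s x)) \<circ> (?s y \<circ> w \<circ> inv' (?s y))
      = ?s x \<circ> (three_cyc a (inv' w y) (inv' w x) \<circ> three_cyc x y b) \<circ> inv' (?s x)"
      by (rule conj_quotient) (use bw w xy X in auto)
    ultimately show "cmod (\<phi> (inv\<^bsub>alt_group n\<^esub> (?s x \<circ> w \<circ> inv' (?s x)) \<otimes>\<^bsub>alt_group n\<^esub>
        (?s y \<circ> w \<circ> inv' (?s y)))) \<le> d"
      using le[OF xy] character_alt_group_conj[OF \<phi> _ s[OF xy(1)]] sw[OF xy(1)]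
      by (simp add: alt_group_mult alt_group_inv_equality)
  qed
qed

text \<open>First round: when \<open>x\<close> and \<open>y\<close> are fixed by \<open>w\<close>,
  the product collapses to one 3-cycle, where \<open>\<phi>\<close> is zero. Hence
  \<open>d = 0\<close>.\<close>

lemma character_bound_fixed_points:
  assumes \<phi>: "\<phi> \<in> characters (alt_group n)"
    and zero: "\<And>a b c. a \<noteq> b \<Longrightarrow> b \<noteq> c \<Longrightarrow> a \<noteq> c \<Longrightarrow> {a, b, c} \<subseteq> {1..n} \<Longrightarrow> \<phi> (three_cyc a b c) = 0"
    and w: "w \<in> carrier (alt_group n)" "w \<noteq> id"
    and X: "X \<subseteq> {1..n}" "X \<noteq> {}" "\<And>x. x \<in> X \<Longrightarrow> w x = x"
  shows "cmod (\<phi> w)^2 \<le> 1 / real (card X)"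
proof -
  have wp: "w permutes {1..n}" using w by (simp add: alt_group_carrier)
  obtain a where a: "w a \<noteq> a" using w(2) by (metis eq_id_iff)
  have ww: "w (w a) \<noteq> w a" using a permutes_inj[OF wp] by (metis injD)
  have ab: "a \<in> {1..n}" "w a \<in> {1..n}"
    using a wp permutes_not_in permutes_in_image by metis+
  have Xab: "X \<subseteq> {1..n} - {a, w a}" using X a ww by auto
  have "cmod (\<phi> w)^2 \<le> 1 / real (card X) + 0"
  proof (rule character_alt_group_conj_bound[OF \<phi> w(1) refl _ Xab X(2)])
    fix x y assume xy: "x \<in> X" "y \<in> X" "x \<noteq> y"
    have "inv' w x = x" "inv' w y = y"
      using X(3) xy permutes_inverses[OF wp] by metis+
    moreover have "three_cyc a y x \<circ> three_cyc x y (w a) = three_cyc (w a) a y"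
    proof -
      have "x \<noteq> a" "y \<noteq> a" "x \<noteq> w a" "y \<noteq> w a" using xy Xab by auto
      then show ?thesis using xy(3) a unfolding fun_eq_iff comp_apply
        by (simp add: three_cyc_apply)
    qed
    moreover have "\<phi> (three_cyc (w a) a y) = 0"
      by (rule zero) (use xy Xab a ab in auto)
    ultimately show "cmod (\<phi> (three_cyc a (inv' w y) (inv' w x) \<circ> three_cyc x y (w a))) \<le> 0"
      by simp
  qed (use a in auto)
  then show ?thesis by simp
qed

text \<open>Second round, for \<open>w\<close> with possibly no fixed points: the quotient
  \<open>?u\<close> of two conjugates fixes at least \<open>n - 6\<close> points, so the first round
  bounds \<open>\<phi>\<close> at \<open>?u\<close>. This bound serves as \<open>d\<close> for the
  \<open>n - 2\<close> conjugates of \<open>w\<close>.\<close>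

lemma character_alt_group_small:
  assumes n: "7 \<le> n" and \<phi>: "\<phi> \<in> characters (alt_group n)"
    and zero: "\<And>a b c. a \<noteq> b \<Longrightarrow> b \<noteq> c \<Longrightarrow> a \<noteq> c \<Longrightarrow> {a, b, c} \<subseteq> {1..n} \<Longrightarrow> \<phi> (three_cyc a b c) = 0"
    and w: "w \<in> carrier (alt_group n)" "w \<noteq> id"
  shows "cmod (\<phi> w)^2 \<le> 1 / real (n - 2) + sqrt (1 / real (n - 6))"
proof -
  interpret alt: group "alt_group n" by (rule alt_group_is_group)
  have wp: "w permutes {1..n}" using w by (simp add: alt_group_carrier)
  obtain a where a: "w a \<noteq> a" using w(2) by (metis eq_id_iff)
  have ab: "a \<in> {1..n}" "w a \<in> {1..n}"
    using a wp permutes_not_in permutes_in_image by metis+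
  have card: "card ({1..n} - {a, w a}) = n - 2"
    using ab a by (subst card_Diff_subset) auto
  have "cmod (\<phi> w)^2 \<le> 1 / real (card ({1..n} - {a, w a})) + sqrt (1 / real (n - 6))"
  proof (rule character_alt_group_conj_bound[OF \<phi> w(1) refl _ subset_refl])
    show "{1..n} - {a, w a} \<noteq> {}"
    proof
      assume "{1..n} - {a, w a} = {}"
      with card have "n - 2 = 0" by (simp only: card.empty)
      with n show False by simp
    qed

    fix x y assume xy: "x \<in> {1..n} - {a, w a}" "y \<in> {1..n} - {a, w a}" "x \<noteq> y"
    let ?x = "inv' w x" and ?y = "inv' w y"
    let ?u = "three_cyc a ?y ?x \<circ> three_cyc x y (w a)"
    have i: "?y \<in> {1..n}" "?x \<in> {1..n}" "?y \<noteq> ?x" "a \<noteq> ?y" "a \<noteq> ?x"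
      using xy permutes_in_image[OF permutes_inv[OF wp]]
        permutes_inverses[OF wp] by (blast, blast, metis, metis DiffD2 insertI1 insertI2, metis DiffD2 insertI1 insertI2)
    have u: "?u \<in> carrier (alt_group n)"
      using alt.m_closed[OF three_cyc_in_alt_group three_cyc_in_alt_group, of a ?y ?x x y "w a"]
        xy i ab by (auto simp: alt_group_mult)
    \<comment> \<open>The first round applies only to nontrivial elements.\<close>
    have "?u a = ?y" using xy a i by (auto simp: three_cyc_apply)
    then have "?u \<noteq> id" using i by (metis id_apply)
    let ?X = "{1..n} - {a, w a, x, y, ?x, ?y}"
    \<comment> \<open>Only an upper bound, since some of the six points may coincide.\<close>
    have "card {a, w a, x, y, ?x, ?y} \<le> 6"
      using card_length[of "[a, w a, x, y, ?x, ?y]"] by (simp only: list.set list.size)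
    moreover have "card {1..n} - card {a, w a, x, y, ?x, ?y} \<le> card ?X"
      by (rule diff_card_le_card_Diff) simp
    ultimately have cX: "n - 6 \<le> card ?X" unfolding card_atLeastAtMost by linarith
    then have "0 < card ?X" using n by linarith
    then have "?X \<noteq> {}" by (intro notI) (simp only: card.empty less_irrefl)
    have fixed: "?u v = v" if "v \<in> ?X" for v
      using that xy i by (simp add: three_cyc_apply)
    have "cmod (\<phi> ?u)^2 \<le> 1 / real (card ?X)"
      by (rule character_bound_fixed_points[OF \<phi> zero u \<open>?u \<noteq> id\<close> Diff_subset \<open>?X \<noteq> {}\<close> fixed])
    also have "\<dots> \<le> 1 / real (n - 6)"
      using cX n by (intro frac_le; linarith)
    finally show "cmod (\<phi> ?u) \<le> sqrt (1 / real (n - 6))"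
      by (rule real_le_rsqrt)
  qed (use a in auto)
  then show ?thesis by (simp only: card)
qed

section \<open>From alternating groups to unions of chains\<close>

lemma characters_pullback:
  fixes K :: "('a, 'c) monoid_scheme" and G :: "('b, 'd) monoid_scheme"
  assumes "group K" "group G" and f: "f \<in> hom K G" and \<phi>: "\<phi> \<in> characters G"
  shows "restrict (\<phi> \<circ> f) (carrier K) \<in> characters K"
proof -
  interpret group_hom K G f
    using assms by (simp add: group_hom_def group_hom_axioms_def)
  have "positive_definite_on_group K (restrict (\<phi> \<circ> f) (carrier K))"
    unfolding positive_definite_on_group_def
  proof (intro allI impI)
    fix n and g :: "nat \<Rightarrow> 'a" and c :: "nat \<Rightarrow> complex"
    assume g: "\<forall>i<n. g i \<in> carrier K"
    have "(\<Sum>i<n. \<Sum>j<n. cnj (c i) * c j * \<phi> (inv\<^bsub>G\<^esub> (f (g i)) \<otimes>\<^bsub>G\<^esub> f (g j))) \<in> \<real>\<^sub>\<ge>\<^sub>0"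
      using \<phi> g unfolding characters_def positive_definite_on_group_def
      by (auto dest!: spec[of _ n] spec[of _ "\<lambda>i. f (g i)"] spec[of _ c])
    also have "(\<Sum>i<n. \<Sum>j<n. cnj (c i) * c j * \<phi> (inv\<^bsub>G\<^esub> (f (g i)) \<otimes>\<^bsub>G\<^esub> f (g j)))
      = (\<Sum>i<n. \<Sum>j<n. cnj (c i) * c j * restrict (\<phi> \<circ> f) (carrier K) (inv\<^bsub>K\<^esub> (g i) \<otimes>\<^bsub>K\<^esub> g j))"
      using g by (intro sum.cong refl) simp
    finally show "\<dots> \<in> \<real>\<^sub>\<ge>\<^sub>0" .
  qed
  then show ?thesis
    using \<phi> by (auto simp: characters_def)
qed

lemma character_alt_group_bound_tendsto:
  "(\<lambda>n. 1 / real (n - 2) + sqrt (1 / real (n - 6))) \<longlonglongrightarrow> 0"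
proof -
  \<comment> \<open>Shifting the index by \<open>k\<close> removes the truncated
    subtraction.\<close>
  have *: "(\<lambda>n. 1 / real (n - k)) \<longlonglongrightarrow> 0" for k
    by (rule LIMSEQ_offset[of _ k]) (simp add: lim_1_over_n)
  show ?thesis
    using tendsto_add[OF *[of 2] tendsto_real_sqrt[OF *[of 6]]] by simp
qed

text \<open>Counting: a strictly increasing chain of finite sets has at least \<open>i\<close>
  elements at stage \<open>i\<close>, while a copy of \<open>alt_group n\<close> has at most
  \<open>fact n\<close>. A late stage therefore has large degree.\<close>

lemma alt_group_degree_unbounded:
  fixes G :: "('a, 'b) monoid_scheme" and H :: "nat \<Rightarrow> 'a set"
  assumes "strict_mono H" and iso: "\<And>i. \<exists>n. G\<lparr>carrier := H i\<rparr> \<cong> alt_group n"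
  shows "\<exists>i n. j \<le> i \<and> N \<le> n \<and> G\<lparr>carrier := H i\<rparr> \<cong> alt_group n"
proof -
  have card_le: "finite (H i) \<and> card (H i) \<le> fact n" if n: "G\<lparr>carrier := H i\<rparr> \<cong> alt_group n" for i n
  proof -
    obtain f where "f \<in> iso (G\<lparr>carrier := H i\<rparr>) (alt_group n)"
      using n by (auto simp: is_iso_def)
    then have bij: "bij_betw f (H i) (carrier (alt_group n))"
      by (simp add: iso_def)
    have sub: "carrier (alt_group n) \<subseteq> carrier (sym_group n)"
      by (auto simp: alt_group_carrier sym_group_carrier)
    have fin: "finite (carrier (sym_group n))"
      by (simp add: sym_group_def finite_permutations)
    show ?thesis
      using bij_betw_finite[OF bij] bij_betw_same_card[OF bij] finite_subset[OF sub fin]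
        card_mono[OF fin sub] sym_group_card_carrier by simp
  qed
  have ge: "i \<le> card (H i)" for i
  proof (induction i)
    case (Suc i)
    have "H i \<subset> H (Suc i)" using assms(1) by (simp add: strict_mono_Suc_iff)
    then show ?case
      using psubset_card_mono[of "H (Suc i)" "H i"] card_le iso[of "Suc i"] Suc by fastforce
  qed simp
  define i where "i = max j (Suc (fact N))"
  obtain n where n: "G\<lparr>carrier := H i\<rparr> \<cong> alt_group n" using iso by blast
  have "fact N < i" by (simp add: i_def)
  also have "\<dots> \<le> fact n" using ge[of i] card_le[OF n] by simp
  finally have "(fact N :: nat) < fact n" .
  then have "N \<le> n" by (metis fact_mono_nat linorder_not_le nat_le_linear)
  moreover have "j \<le> i" by (simp add: i_def)
  ultimately show ?thesis using n by blast
qed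

text \<open>The threshold \<open>N\<close> depends on \<open>r\<close> alone, so it can be fixed
  before the stage of the chain is chosen and used for two characters at once.\<close>

lemma alt_group_eventually_nonzero_three_cyc:
  assumes "(r::real) > 0"
  obtains N where "\<And>n \<phi> w. \<lbrakk>N \<le> n; \<phi> \<in> characters (alt_group n); w \<in> carrier (alt_group n);
    w \<noteq> id; r \<le> cmod (\<phi> w)\<rbrakk> \<Longrightarrow> 5 \<le> n \<and> \<phi> (three_cyc 1 2 3) \<noteq> 0"
proof -
  have "eventually (\<lambda>n. 1 / real (n - 2) + sqrt (1 / real (n - 6)) < r^2) sequentially"
    using assms by (intro order_tendstoD(2)[OF character_alt_group_bound_tendsto]) simp
  then obtain N where N: "\<And>n. N \<le> n \<Longrightarrow> 1 / real (n - 2) + sqrt (1 / real (n - 6)) < r^2"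
    by (auto simp: eventually_sequentially)
  \<comment> \<open>The 7 meets the degree condition of \<open>character_alt_group_small\<close>,
    and that of \<open>character_three_cyc_eq\<close> as well.\<close>
  show thesis
  proof (rule that[of "max N 7"])
    fix n \<phi> w
    assume n: "max N 7 \<le> n" and \<phi>: "\<phi> \<in> characters (alt_group n)"
      and w: "w \<in> carrier (alt_group n)" "w \<noteq> id" and r: "r \<le> cmod (\<phi> w)"
    have "\<phi> (three_cyc 1 2 3) \<noteq> 0"
    proof
      assume z: "\<phi> (three_cyc 1 2 3) = 0"
      have "\<phi> (three_cyc a b c) = 0" if "a \<noteq> b" "b \<noteq> c" "a \<noteq> c" "{a, b, c} \<subseteq> {1..n}" for a b c
      proof -
        have "\<phi> (three_cyc a b c) = \<phi> (three_cyc 1 2 3)"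
          by (rule character_three_cyc_eq[OF _ \<phi> that]) (use n in auto)
        with z show ?thesis by simp
      qed
      then have "cmod (\<phi> w)^2 \<le> 1 / real (n - 2) + sqrt (1 / real (n - 6))"
        using n by (intro character_alt_group_small[OF _ \<phi> _ w]) auto
      also have "\<dots> < r^2" by (rule N) (use n in simp)
      also have "\<dots> \<le> cmod (\<phi> w)^2" using assms r by (intro power_mono) auto
      finally show False by simp
    qed
    then show "5 \<le> n \<and> \<phi> (three_cyc 1 2 3) \<noteq> 0" using n by simp
  qed
qed

lemma delta_e_eqI:
  assumes "\<phi> \<in> characters G" "\<And>g. g \<in> carrier G - {\<one>\<^bsub>G\<^esub>} \<Longrightarrow> \<phi> g = 0"
  shows "\<phi> = delta_e G"
proof
  fix x
  show "\<phi> x = delta_e G x"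
    using assms by (cases "x \<in> carrier G") (auto simp: characters_def delta_e_def extensional_def)
qed

text \<open>Points where \<open>\<phi>\<close> and \<open>\<psi>\<close> are nonzero lie in a common
  stage of large degree. Pulled back to that alternating group, both characters are nonzero at the
  same 3-cycle, whose image is the required \<open>s\<close>.\<close>

lemma L_Alt_group_characters_common_nonzero:
  fixes G :: "('a, 'b) monoid_scheme"
  assumes "group G" and "L_Alt_group G"
    and \<phi>: "\<phi> \<in> characters G" "\<phi> \<noteq> delta_e G" and \<psi>: "\<psi> \<in> characters G" "\<psi> \<noteq> delta_e G"
  shows "\<exists>s \<in> carrier G - {\<one>\<^bsub>G\<^esub>}. \<phi> s * \<psi> s \<noteq> 0"
proof -
  interpret group G by fact
  obtain H :: "nat \<Rightarrow> 'a set" where H: "strict_mono H" "\<And>i. subgroup (H i) G"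
    "\<And>i. \<exists>n. G\<lparr>carrier := H i\<rparr> \<cong> alt_group n" "carrier G = (\<Union>i. H i)"
    using assms(2) unfolding L_Alt_group_def by blast
  obtain g where g: "g \<in> carrier G - {\<one>\<^bsub>G\<^esub>}" "\<phi> g \<noteq> 0" using delta_e_eqI \<phi> by metis
  obtain h where h: "h \<in> carrier G - {\<one>\<^bsub>G\<^esub>}" "\<psi> h \<noteq> 0" using delta_e_eqI \<psi> by metis
  obtain ig ih where i: "g \<in> H ig" "h \<in> H ih" using g h H(4) by blast
  \<comment> \<open>The minimum makes one threshold serve both characters.\<close>
  define r where "r = min (cmod (\<phi> g)) (cmod (\<psi> h))"
  have "r > 0" using g h by (simp add: r_def)
  obtain N where N: "\<And>n \<phi> w. \<lbrakk>N \<le> n; \<phi> \<in> characters (alt_group n); w \<in> carrier (alt_group n);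
    w \<noteq> id; r \<le> cmod (\<phi> w)\<rbrakk> \<Longrightarrow> 5 \<le> n \<and> \<phi> (three_cyc 1 2 3) \<noteq> 0"
    using alt_group_eventually_nonzero_three_cyc[OF \<open>r > 0\<close>] by metis
  obtain j n where jn: "max ig ih \<le> j" "N \<le> n" "G\<lparr>carrier := H j\<rparr> \<cong> alt_group n"
    using alt_group_degree_unbounded[OF H(1) H(3)] by metis
  have gpH: "group (G\<lparr>carrier := H j\<rparr>)"
    using H(2) subgroup.subgroup_is_group is_group by blast
  obtain f where f: "f \<in> iso (alt_group n) (G\<lparr>carrier := H j\<rparr>)"
    using group.iso_sym[OF gpH jn(3)] by (auto simp: is_iso_def)
  have HG: "H j \<subseteq> carrier G" using H(4) by blast
  then have hom: "f \<in> hom (alt_group n) G"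
    using f by (auto simp: iso_def hom_def)
  have bij: "bij_betw f (carrier (alt_group n)) (H j)" using f by (simp add: iso_def)
  interpret f: group_hom "alt_group n" G f
    using hom by (simp add: group_hom_def group_hom_axioms_def alt_group_is_group is_group)
  have f1: "f id = \<one>\<^bsub>G\<^esub>" using f.hom_one by (simp add: alt_group_one)
  have id: "id \<in> carrier (alt_group n)" by (simp add: alt_group_carrier permutes_id)
  have three: "5 \<le> n \<and> \<xi> (f (three_cyc 1 2 3)) \<noteq> 0"
    if \<xi>: "\<xi> \<in> characters G" and s: "s \<in> H j" "s \<noteq> \<one>\<^bsub>G\<^esub>" "r \<le> cmod (\<xi> s)" for \<xi> s
  proof -
    let ?\<xi> = "restrict (\<xi> \<circ> f) (carrier (alt_group n))"
    obtain w where w: "w \<in> carrier (alt_group n)" "f w = s"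
      using bij s(1) by (metis bij_betw_imp_surj_on imageE)
    have "w \<noteq> id" using w s f1 by auto
    then have *: "5 \<le> n \<and> ?\<xi> (three_cyc 1 2 3) \<noteq> 0"
      using w s by (intro N[OF jn(2) characters_pullback[OF alt_group_is_group assms(1) hom \<xi>] w(1)]) auto
    \<comment> \<open>Membership is what allows the restriction in \<open>?\<xi>\<close> to be
      unfolded at this point.\<close>
    then have "three_cyc 1 2 3 \<in> carrier (alt_group n)"
      by (intro three_cyc_in_alt_group) auto
    with * show ?thesis by simp
  qed
  have "g \<in> H j" "h \<in> H j"
    using i jn(1) strict_mono_mono[OF H(1)] by (auto simp: mono_def dest!: subsetD)
  with g h have nz: "5 \<le> n" "\<phi> (f (three_cyc 1 2 3)) \<noteq> 0" "\<psi> (f (three_cyc 1 2 3)) \<noteq> 0"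
    using three[OF \<phi>(1), of g] three[OF \<psi>(1), of h] by (auto simp: r_def)
  have t: "three_cyc 1 2 3 \<in> carrier (alt_group n)"
    using nz by (intro three_cyc_in_alt_group) auto
  have "three_cyc 1 2 (3::nat) 1 \<noteq> id 1" by (simp add: three_cyc_apply)
  then have "three_cyc 1 2 (3::nat) \<noteq> id" by metis
  then have "f (three_cyc 1 2 3) \<noteq> \<one>\<^bsub>G\<^esub>"
    using bij t id f1 by (metis bij_betw_def inj_onD)
  then show ?thesis
    using nz t f.hom_closed by (intro bexI[of _ "f (three_cyc 1 2 3)"]) auto
qed

theorem proposition3p10:
  fixes G :: "('a, 'b) monoid_scheme"
  assumes "group G"
    and "infinite (carrier G)"
    and "countable (carrier G)"
    and "icc G"
    and "is_simple G"
    and "character_rigid G \<or> L_Alt_group G"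
  shows "non_factorizable_regular_character G"
  unfolding non_factorizable_regular_character_def
proof (intro ballI impI)
  fix \<phi> \<psi>
  assume \<phi>: "\<phi> \<in> characters G" and \<psi>: "\<psi> \<in> characters G"
    and zero: "\<forall>s \<in> carrier G - {\<one>\<^bsub>G\<^esub>}. \<phi> s * \<psi> s = 0"
  show "\<phi> = delta_e G \<or> \<psi> = delta_e G"
  proof (cases "L_Alt_group G")
    case True
    then show ?thesis
      using L_Alt_group_characters_common_nonzero[OF assms(1) True \<phi> _ \<psi>] zero by blast
  next
    case False
    then have "character_rigid G" using assms by blast
    note const = character_rigid_constant_off_one[OF assms(1,3) this]
    \<comment> \<open>One of the characters vanishes at such an \<open>s\<close>, and constancy off
      the identity spreads the zero to all other nontrivial elements.\<close>
    have "\<exists>s. s \<in> carrier G - {\<one>\<^bsub>G\<^esub>}"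
      using assms(5) group.is_monoid[OF assms(1)] monoid.one_closed unfolding is_simple_def by blast
    then obtain s where s: "s \<in> carrier G - {\<one>\<^bsub>G\<^esub>}" ..
    then have "\<phi> s = 0 \<or> \<psi> s = 0" using zero by simp
    then show ?thesis
      using const[OF \<phi> _ s] const[OF \<psi> _ s] delta_e_eqI[OF \<phi>] delta_e_eqI[OF \<psi>] by auto
  qed
qed

end
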